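(* Let $(X;\mathcal L_1,\dots,\mathcal L_k)$ be a multiple covering clutter with $X=[d]$ in which all lines have the same size; let $s\subseteq\mathbb{R}^d$ be the subspace in which, for each $i$, all line sums over lines of $\mathcal L_i$ are equal; $P:=[0,1]^d\cap s$; $\Gamma_{\mathcal L}$ the graph joining any two distinct collinear points; and $\mathcal H:=\{h_{jk}\cap s : jk \text{ an edge of }\Gamma_{\mathcal L},\ h_{jk}\not\supseteq s\}$ with $h_{jk}$ the hyperplane $x_j=x_k$. Assume a latin labelling exists, i.e. an integer point of $s$ whose values at any two distinct collinear points differ. Let $L_c^\circ(t)$ be the number of latin labellings $x\in\mathbb{Z}^d\cap s$ with $0<x_i<t$, and $L_c(t)$ the number of pairs consisting of an integer point $x\in s$ with $0\le x_i\le t$ and an acyclic orientation of $\Gamma_{\mathcal L}$ compatible with $x$ and realizable in $s$. Then $$L_c^\circ(t)=\sum_{u\in\mathcal L(P^\circ,\mathcal H)}\mu(\hat0,u)\,E_{(0,1)^d\cap u}(t),\qquad L_c(t)=\sum_{u\in\mathcal L(P^\circ,\mathcal H)}|\mu(\hat0,u)|\,E_{[0,1]^d\cap u}(t),$$ where $\mu$ is the Möbius function of $\mathcal L(P^\circ,\mathcal H)$.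
   Context: Covering clutter: family of nonempty subsets (lines) of $X$, none containing another, with union $X$; a multiple covering clutter is a list of such on the same $X$. An orientation is acyclic if it has no directed cycle, compatible with $x$ if $x_j\ge x_i$ for each edge oriented $i\to j$, realizable in $s$ if some $x\in s$ has $x_j>x_i$ for each edge oriented $i\to j$. $\mathcal L(P^\circ,\mathcal H):=\{P^\circ\cap\bigcap\mathcal S:\mathcal S\subseteq\mathcal H\}\setminus\{\emptyset\}$ ordered by reverse inclusion, bottom $\hat0=P^\circ$ (relative interior of $P$). $E_{Q\cap u}(t)$ is the number of integer points in $t(Q\cap\bar u)$, where $\bar u=\bigcap\mathcal S$ is the flat whose intersection with $P^\circ$ is $u$. Möbius function: $\mu(r,r)=1$, $\mu(r,s)=-\sum_{r\le w<s}\mu(r,w)$ for $r<s$. *)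

theory Defs
  imports "HOL-Analysis.Analysis"
begin

definition covering_clutter :: "'a set \<Rightarrow> 'a set set \<Rightarrow> bool" where
  "covering_clutter X L \<longleftrightarrow>
     {} \<notin> L \<and> (\<forall>l\<in>L. \<forall>m\<in>L. l \<subseteq> m \<longrightarrow> l = m) \<and> \<Union>L = X"

definition multiple_covering_clutter :: "'a set \<Rightarrow> 'a set set list \<Rightarrow> bool" where
  "multiple_covering_clutter X Ls \<longleftrightarrow> (\<forall>L\<in>set Ls. covering_clutter X L)"

definition same_line_size :: "'a set set list \<Rightarrow> bool" where
  "same_line_size Ls \<longleftrightarrow>
     (\<forall>l\<in>\<Union>(set Ls). \<forall>m\<in>\<Union>(set Ls). card l = card m)"

text \<open>The point set \<open>[d]\<close> is the index type \<open>'n\<close>, so \<open>d = CARD('n)\<close>.\<close>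

definition line_sum_space :: "'n set set list \<Rightarrow> (real ^ 'n::finite) set" where
  "line_sum_space Ls =
     {x. \<forall>L\<in>set Ls. \<forall>l\<in>L. \<forall>m\<in>L. (\<Sum>i\<in>l. x $ i) = (\<Sum>i\<in>m. x $ i)}"

definition collinear_points :: "'a set set list \<Rightarrow> 'a \<Rightarrow> 'a \<Rightarrow> bool" where
  "collinear_points Ls i j \<longleftrightarrow> (\<exists>L\<in>set Ls. \<exists>l\<in>L. i \<in> l \<and> j \<in> l)"

definition clutter_graph :: "'a set set list \<Rightarrow> 'a set set" where
  "clutter_graph Ls = {{i, j} | i j. i \<noteq> j \<and> collinear_points Ls i j}"

definition integer_points :: "(real ^ 'n::finite) set" where
  "integer_points = {x. \<forall>i. x $ i \<in> \<int>}"

definition latin_labelling :: "'n set set list \<Rightarrow> real ^ 'n::finite \<Rightarrow> bool" where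
  "latin_labelling Ls x \<longleftrightarrow>
     x \<in> integer_points \<inter> line_sum_space Ls \<and>
     (\<forall>i j. i \<noteq> j \<and> collinear_points Ls i j \<longrightarrow> x $ i \<noteq> x $ j)"

text \<open>A pair \<open>(i, j)\<close> in an orientation is an edge oriented from \<open>i\<close> to \<open>j\<close>; acyclicity is then
  \<^const>\<open>acyclic\<close>.\<close>

definition orientation :: "'a set set \<Rightarrow> ('a \<times> 'a) set \<Rightarrow> bool" where
  "orientation E A \<longleftrightarrow>
     (\<forall>(i, j)\<in>A. {i, j} \<in> E) \<and>
     (\<forall>i j. {i, j} \<in> E \<longrightarrow> ((i, j) \<in> A \<longleftrightarrow> (j, i) \<notin> A))"

definition compatible :: "('n \<times> 'n) set \<Rightarrow> real ^ 'n::finite \<Rightarrow> bool" where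
  "compatible A x \<longleftrightarrow> (\<forall>(i, j)\<in>A. x $ j \<ge> x $ i)"

definition realizable_in :: "('n \<times> 'n) set \<Rightarrow> (real ^ 'n::finite) set \<Rightarrow> bool" where
  "realizable_in A s \<longleftrightarrow> (\<exists>x\<in>s. \<forall>(i, j)\<in>A. x $ j > x $ i)"

definition coord_hyperplane :: "'n \<Rightarrow> 'n \<Rightarrow> (real ^ 'n::finite) set" where
  "coord_hyperplane j k = {x. x $ j = x $ k}"

definition clutter_polytope :: "'n set set list \<Rightarrow> (real ^ 'n::finite) set" where
  "clutter_polytope Ls = cbox 0 1 \<inter> line_sum_space Ls"

definition clutter_arrangement :: "'n set set list \<Rightarrow> (real ^ 'n::finite) set set" where
  "clutter_arrangement Ls =
     {coord_hyperplane j k \<inter> line_sum_space Ls | j k.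
        {j, k} \<in> clutter_graph Ls \<and> \<not> line_sum_space Ls \<subseteq> coord_hyperplane j k}"

definition intersection_poset :: "'a set \<Rightarrow> 'a set set \<Rightarrow> 'a set set" where
  "intersection_poset C H = {C \<inter> \<Inter>S | S. S \<subseteq> H} - {{}}"

text \<open>The arrangement \<open>H\<close> lives in the ambient space \<open>s\<close>, so the intersection of the empty
  subfamily is \<open>s\<close>, not the whole type. For nonempty \<open>u\<close> in the intersection poset of \<open>C\<close> and
  \<open>H\<close>, with \<open>C\<close> the relative interior of the polytope, the flat below is unique.\<close>

definition flat_of :: "'a set \<Rightarrow> 'a set \<Rightarrow> 'a set set \<Rightarrow> 'a set \<Rightarrow> 'a set" where
  "flat_of s C H u = (THE f. (\<exists>S\<subseteq>H. f = s \<inter> \<Inter>S) \<and> C \<inter> f = u)"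

definition dilate_count :: "(real ^ 'n::finite) set \<Rightarrow> nat \<Rightarrow> nat" where
  "dilate_count Q t = card (integer_points \<inter> (\<lambda>x. real t *\<^sub>R x) ` Q)"

text \<open>The Moebius function of a finite family \<open>A\<close> of sets ordered by reverse inclusion, so
  \<open>r \<le> w < u\<close> reads \<open>u \<subset> w \<subseteq> r\<close>.\<close>

function poset_moebius :: "'a set set \<Rightarrow> 'a set \<Rightarrow> 'a set \<Rightarrow> int" where
  "poset_moebius A r u =
     (if finite A \<and> r \<in> A \<and> u \<in> A \<and> u \<subseteq> r
      then if u = r then 1 else - (\<Sum>w\<in>{w \<in> A. u \<subset> w \<and> w \<subseteq> r}. poset_moebius A r w)
      else 0)"
  by auto
termination
proof (relation "Wellfounded.measure (\<lambda>(A, r, u). card {w \<in> A. u \<subset> w})", goal_cases)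
  case (2 A r u w)
  then have "{v \<in> A. w \<subset> v} \<subset> {v \<in> A. u \<subset> v}" by auto
  with 2 show ?case by (auto intro!: psubset_card_mono)
qed auto

declare poset_moebius.simps [simp del]

definition latin_count_open :: "'n::finite set set list \<Rightarrow> nat \<Rightarrow> nat" where
  "latin_count_open Ls t =
     card {x :: real ^ 'n. latin_labelling Ls x \<and> (\<forall>i. 0 < x $ i \<and> x $ i < real t)}"

definition latin_count_closed :: "'n::finite set set list \<Rightarrow> nat \<Rightarrow> nat" where
  "latin_count_closed Ls t =
     card {(x :: real ^ 'n, A).
       x \<in> integer_points \<inter> line_sum_space Ls \<and> (\<forall>i. 0 \<le> x $ i \<and> x $ i \<le> real t) \<and>
       orientation (clutter_graph Ls) A \<and> acyclic A \<and>
       compatible A x \<and> realizable_in A (line_sum_space Ls)}"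

end

theory Submission
  imports Defs
begin

text \<open>All flats of the arrangement contain the centre of the cube, so the poset of the theorem is the
  intersection lattice of a central arrangement, and Whitney's formula expresses
  \<open>\<mu>(0, f)\<close> as the alternating count of the sets of edges whose hyperplanes meet in \<open>f\<close>.
  For the first identity, interchange the sums: a point \<open>x\<close> contributes the alternating count of
  all subsets of the set of edges on which \<open>x\<close> has a tie, which vanishes unless there is no tie.
  For the second, \<open>\<mu>(0, f)\<close> has sign \<open>(-1)\<close> to the codimension of \<open>f\<close>, so \<open>x\<close> contributes
  the number of chambers of the arrangement of hyperplanes through \<open>x\<close> (Zaslavsky's theorem), and
  these chambers correspond to the realizable orientations compatible with \<open>x\<close>. Both the sign
  statement and Zaslavsky's theorem follow by deletion and restriction; allowing repeated and zero
  normal vectors makes the induction uniform.\<close>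

section \<open>Flats, Whitney sums and chambers of a central arrangement\<close>

text \<open>The ambient subspace \<open>V\<close> is a parameter so that restriction to a hyperplane
  keeps the same form: only \<open>V\<close> shrinks, while the normals keep their indices and need
  not lie in \<open>V\<close>.\<close>

definition zero_flat :: "'v::real_inner set \<Rightarrow> ('i \<Rightarrow> 'v) \<Rightarrow> 'i set \<Rightarrow> 'v set" where
  "zero_flat V a S = {x \<in> V. \<forall>i\<in>S. a i \<bullet> x = 0}"

text \<open>Whitney's expression for the Moebius value of \<open>f\<close>. It makes sense for any
  set \<open>f\<close> and vanishes off the flats, so deletion and restriction need no case
  distinction on \<open>f\<close>.\<close>

definition whitney_sum :: "'v::real_inner set \<Rightarrow> ('i \<Rightarrow> 'v) \<Rightarrow> 'i set \<Rightarrow> 'v set \<Rightarrow> int" where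
  "whitney_sum V a I f = (\<Sum>S | S \<subseteq> I \<and> zero_flat V a S = f. (-1) ^ card S)"

definition has_signs :: "('i \<Rightarrow> 'v::real_inner) \<Rightarrow> 'i set \<Rightarrow> 'i set \<Rightarrow> 'v \<Rightarrow> bool" where
  "has_signs a I B x \<longleftrightarrow> (\<forall>i\<in>I. if i \<in> B then 0 < a i \<bullet> x else a i \<bullet> x < 0)"

text \<open>A chamber is encoded by the indices whose normals are positive on it. Strict signs cut
  out a convex cone, so each realized sign pattern is a single region.\<close>

definition chambers :: "'v::real_inner set \<Rightarrow> ('i \<Rightarrow> 'v) \<Rightarrow> 'i set \<Rightarrow> 'i set set" where
  "chambers V a I = {B. B \<subseteq> I \<and> (\<exists>x\<in>V. has_signs a I B x)}"

lemma zero_flat_empty [simp]: "zero_flat V a {} = V"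
  by (auto simp: zero_flat_def)

lemma zero_flat_insert: "zero_flat V a (insert i S) = zero_flat (zero_flat V a {i}) a S"
  by (auto simp: zero_flat_def)

lemma subspace_zero_flat: "subspace V \<Longrightarrow> subspace (zero_flat V a S)"
  by (auto simp: subspace_def zero_flat_def inner_right_distrib)

lemma sum_Pow_insert:
  fixes g :: "'i set \<Rightarrow> 'b::comm_monoid_add"
  assumes "finite I" "i \<notin> I"
  shows "(\<Sum>S\<in>Pow (insert i I). g S) = (\<Sum>S\<in>Pow I. g S) + (\<Sum>S\<in>Pow I. g (insert i S))"
proof -
  have "inj_on (insert i) (Pow I)"
    using assms(2) by (auto simp: inj_on_def insert_ident subset_iff)
  moreover have "Pow I \<inter> insert i ` Pow I = {}"
    using assms(2) by auto
  ultimately show ?thesis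
    using assms(1) by (simp add: Pow_insert sum.union_disjoint sum.reindex)
qed

section \<open>Deletion and restriction for Whitney sums\<close>

lemma whitney_sum_Pow:
  assumes "finite I"
  shows "whitney_sum V a I f = (\<Sum>S\<in>Pow I. if zero_flat V a S = f then (-1) ^ card S else 0)"
  using assms by (simp add: whitney_sum_def flip: sum.inter_filter)

text \<open>Removing \<open>i\<close> from an index set that contains it flips the sign and passes
  the equation of \<open>i\<close> on to the ambient subspace.\<close>

lemma whitney_sum_insert:
  assumes "finite I" "i \<notin> I"
  shows "whitney_sum V a (insert i I) f =
           whitney_sum V a I f - whitney_sum (zero_flat V a {i}) a I f"
proof -
  have "(\<Sum>S\<in>Pow I. if zero_flat V a (insert i S) = f then (-1) ^ card (insert i S) else 0) =
        (\<Sum>S\<in>Pow I. - (if zero_flat (zero_flat V a {i}) a S = f then (-1) ^ card S else (0::int)))"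
  proof (rule sum.cong)
    fix S assume "S \<in> Pow I"
    then have "card (insert i S) = Suc (card S)"
      using assms by (auto intro!: card_insert_disjoint intro: finite_subset)
    then show "(if zero_flat V a (insert i S) = f then (-1) ^ card (insert i S) else 0) =
        - (if zero_flat (zero_flat V a {i}) a S = f then (-1) ^ card S else (0::int))"
      by (simp add: zero_flat_insert[of V a i S])
  qed simp
  then show ?thesis
    using assms by (simp add: whitney_sum_Pow sum_Pow_insert sum_negf)
qed

lemma dim_zero_flat_singleton:
  fixes V :: "'v::euclidean_space set"
  assumes V: "subspace V" and v: "v \<in> V" "a i \<bullet> v \<noteq> 0"
  shows "dim V = Suc (dim (zero_flat V a {i}))"
proof -
  let ?W = "zero_flat V a {i}"
  have W: "subspace ?W"
    using V by (rule subspace_zero_flat)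
  have "V \<subseteq> span (insert v ?W)"
  proof
    fix x assume x: "x \<in> V"
    \<comment> \<open>The coefficient that projects \<open>x\<close> along \<open>v\<close> onto the
      hyperplane of \<open>i\<close>.\<close>
    define c where "c = (a i \<bullet> x) / (a i \<bullet> v)"
    have "x - c *\<^sub>R v \<in> ?W"
      using V x v by (simp add: zero_flat_def c_def subspace_diff subspace_scale inner_diff_right)
    then have "x - c *\<^sub>R v \<in> span (insert v ?W)"
      by (simp add: span_base)
    moreover have "c *\<^sub>R v \<in> span (insert v ?W)"
      by (simp add: span_base span_scale)
    ultimately show "x \<in> span (insert v ?W)"
      using span_add by fastforce
  qed
  moreover have "insert v ?W \<subseteq> V"
    using v by (auto simp: zero_flat_def)
  ultimately have "dim V = dim (insert v ?W)"
    by (metis dim_subset dim_span le_antisym)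
  moreover have "v \<notin> span ?W"
    using v W by (simp add: span_eq_iff[THEN iffD2] zero_flat_def)
  ultimately show ?thesis
    by (simp add: dim_insert)
qed

text \<open>The sign rule for Moebius values. A proper restriction lowers the dimension by one,
  which cancels the minus sign of deletion and restriction. The induction lets \<open>V\<close>
  vary, since the hypothesis is also applied to the restricted space.\<close>

lemma whitney_sum_alternates:
  fixes V :: "'v::euclidean_space set"
  assumes "finite I" "subspace V"
  shows "0 \<le> (-1) ^ (dim V + dim f) * whitney_sum V a I f"
  using assms
proof (induction I arbitrary: V rule: finite_induct)
  case empty
  show ?case
    by (cases "V = f") (auto simp: whitney_sum_Pow)
next
  case (insert i I)
  show ?case
  proof (cases "\<exists>v\<in>V. a i \<bullet> v \<noteq> 0")
    case True
    then obtain v where "v \<in> V" "a i \<bullet> v \<noteq> 0"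
      by blast
    then have "dim V = Suc (dim (zero_flat V a {i}))"
      using insert.prems by (intro dim_zero_flat_singleton)
    then have "(-1) ^ (dim V + dim f) * whitney_sum V a (insert i I) f =
        (-1) ^ (dim V + dim f) * whitney_sum V a I f +
        (-1) ^ (dim (zero_flat V a {i}) + dim f) * whitney_sum (zero_flat V a {i}) a I f"
      using insert.hyps by (simp add: whitney_sum_insert algebra_simps)
    then show ?thesis
      using insert.IH[of V] insert.IH[of "zero_flat V a {i}"] insert.prems
      by (simp add: subspace_zero_flat)
  next
    case False
    \<comment> \<open>A normal that vanishes on \<open>V\<close> makes the two terms of the
      recursion equal, so they cancel.\<close>
    then have "zero_flat V a {i} = V"
      by (auto simp: zero_flat_def)
    then show ?thesis
      using insert.hyps by (simp add: whitney_sum_insert)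
  qed
qed

lemma abs_whitney_sum:
  fixes V :: "'v::euclidean_space set"
  assumes "finite I" "subspace V"
  shows "\<bar>whitney_sum V a I f\<bar> = (-1) ^ (dim V + dim f) * whitney_sum V a I f"
  using whitney_sum_alternates[OF assms, of f a] by (cases "even (dim V + dim f)") auto

section \<open>Perturbation, and chamber counts under deletion and restriction\<close>

lemma perturb_keeps_signs:
  fixes x v :: "'v::real_inner"
  assumes "finite I"
  obtains e where "0 < e" "\<And>i. i \<in> I \<Longrightarrow> 0 < a i \<bullet> x \<Longrightarrow> 0 < a i \<bullet> (x + e *\<^sub>R v)"
    "\<And>i. i \<in> I \<Longrightarrow> a i \<bullet> x < 0 \<Longrightarrow> a i \<bullet> (x + e *\<^sub>R v) < 0"
proof -
  let ?P = "\<lambda>e i. (0 < a i \<bullet> x \<longrightarrow> 0 < a i \<bullet> (x + e *\<^sub>R v)) \<and>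
    (a i \<bullet> x < 0 \<longrightarrow> a i \<bullet> (x + e *\<^sub>R v) < 0)"
  have "\<forall>\<^sub>F e in at_right 0. ?P e i" for i
  proof -
    \<comment> \<open>Each strict inequality persists near 0 by continuity. The limit is taken from
      the right so that \<open>0 < e\<close> comes along; finiteness of \<open>I\<close> yields one
      common \<open>e\<close>.\<close>
    have lim: "((\<lambda>e. a i \<bullet> (x + e *\<^sub>R v)) \<longlongrightarrow> a i \<bullet> (x + 0 *\<^sub>R v)) (at_right 0)"
      by (intro tendsto_intros)
    consider "0 < a i \<bullet> x" | "a i \<bullet> x < 0" | "a i \<bullet> x = 0"
      by linarith
    then show ?thesis
    proof cases
      case 1
      then have "\<forall>\<^sub>F e in at_right 0. 0 < a i \<bullet> (x + e *\<^sub>R v)"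
        using order_tendstoD(1)[OF lim, of 0] by simp
      then show ?thesis
        by eventually_elim (use 1 in auto)
    next
      case 2
      then have "\<forall>\<^sub>F e in at_right 0. a i \<bullet> (x + e *\<^sub>R v) < 0"
        using order_tendstoD(2)[OF lim, of 0] by simp
      then show ?thesis
        by eventually_elim (use 2 in auto)
    qed simp
  qed
  then have "\<forall>\<^sub>F e in at_right 0. \<forall>i\<in>I. ?P e i"
    using assms by (simp add: eventually_ball_finite)
  moreover have "\<forall>\<^sub>F e in at_right 0. (0::real) < e"
    by (rule eventually_at_right_less)
  ultimately have "\<forall>\<^sub>F e in at_right 0. 0 < e \<and> (\<forall>i\<in>I. ?P e i)"
    by eventually_elim simp
  then have "\<exists>e. 0 < e \<and> (\<forall>i\<in>I. ?P e i)"
    using eventually_happens' trivial_limit_at_right_real by blast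
  then show ?thesis
    using that by blast
qed

lemma has_signs_perturb:
  assumes "finite I" "has_signs a I B x"
  obtains e where "0 < e" "has_signs a I B (x + e *\<^sub>R v)"
proof -
  obtain e where e: "0 < e" "\<And>i. i \<in> I \<Longrightarrow> 0 < a i \<bullet> x \<Longrightarrow> 0 < a i \<bullet> (x + e *\<^sub>R v)"
    "\<And>i. i \<in> I \<Longrightarrow> a i \<bullet> x < 0 \<Longrightarrow> a i \<bullet> (x + e *\<^sub>R v) < 0"
    using perturb_keeps_signs[OF assms(1)] by metis
  then have "has_signs a I B (x + e *\<^sub>R v)"
    using assms(2) unfolding has_signs_def by (simp split: if_splits)
  then show ?thesis
    using e(1) that by blast
qed

lemma has_signs_convex:
  assumes "has_signs a I B x" "has_signs a I B y" "0 < \<alpha>" "0 < \<beta>"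
  shows "has_signs a I B (\<alpha> *\<^sub>R x + \<beta> *\<^sub>R y)"
  using assms unfolding has_signs_def
  by (auto simp: inner_right_distrib mult_pos_neg intro!: add_pos_pos add_neg_neg split: if_splits)

text \<open>Let \<open>Rp\<close> and \<open>Rm\<close> collect the old chambers that reach the
  positive and the negative side of hyperplane \<open>i\<close>. Their union is all old chambers and
  their intersection is those cut by the hyperplane; adding \<open>i\<close> splits exactly the
  latter, so the count is inclusion-exclusion.\<close>

lemma card_chambers_insert:
  assumes I: "finite I" "i \<notin> I" and V: "subspace V" and v: "v \<in> V" "a i \<bullet> v \<noteq> 0"
  shows "card (chambers V a (insert i I)) =
           card (chambers V a I) + card (chambers (zero_flat V a {i}) a I)"
proof -
  define Rp where "Rp = {B. B \<subseteq> I \<and> (\<exists>x\<in>V. has_signs a I B x \<and> 0 < a i \<bullet> x)}"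
  define Rm where "Rm = {B. B \<subseteq> I \<and> (\<exists>x\<in>V. has_signs a I B x \<and> a i \<bullet> x < 0)}"
  obtain w where w: "w \<in> V" "0 < a i \<bullet> w"
  proof (cases "0 < a i \<bullet> v")
    case False
    then have "0 < a i \<bullet> (- v)"
      using v by simp
    then show ?thesis
      using that V v subspace_neg by blast
  qed (use that v in blast)
  \<comment> \<open>A chamber that meets hyperplane \<open>i\<close> reaches both sides: a small
    move along \<open>w\<close> or \<open>- w\<close> keeps its signs over \<open>I\<close>.\<close>
  have up: "B \<in> Rp" if x: "B \<subseteq> I" "x \<in> V" "has_signs a I B x" "a i \<bullet> x = 0" for B x
  proof -
    obtain e where "0 < e" "has_signs a I B (x + e *\<^sub>R w)"
      using has_signs_perturb[OF I(1) x(3)] by blast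
    moreover have "x + e *\<^sub>R w \<in> V"
      using V that w by (simp add: subspace_add subspace_scale)
    ultimately show ?thesis
      using that w by (auto simp: Rp_def inner_right_distrib intro!: bexI[of _ "x + e *\<^sub>R w"])
  qed
  have down: "B \<in> Rm" if x: "B \<subseteq> I" "x \<in> V" "has_signs a I B x" "a i \<bullet> x = 0" for B x
  proof -
    obtain e where "0 < e" "has_signs a I B (x + e *\<^sub>R (- w))"
      using has_signs_perturb[OF I(1) x(3)] by blast
    moreover have "x + e *\<^sub>R (- w) \<in> V"
      using V that w by (intro subspace_add subspace_scale subspace_neg)
    ultimately show ?thesis
      using that w
      by (auto simp: Rm_def inner_diff_right intro!: bexI[of _ "x + e *\<^sub>R (- w)"])
  qed
  have fin: "finite Rp" "finite Rm"
    using I(1) by (auto simp: Rp_def Rm_def)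
  have un: "chambers V a I = Rp \<union> Rm"
  proof (intro set_eqI iffI)
    fix B assume "B \<in> chambers V a I"
    then obtain x where x: "B \<subseteq> I" "x \<in> V" "has_signs a I B x"
      by (auto simp: chambers_def)
    then show "B \<in> Rp \<union> Rm"
      using up[OF x] by (cases "a i \<bullet> x" "0::real" rule: linorder_cases) (auto simp: Rp_def Rm_def)
  qed (auto simp: chambers_def Rp_def Rm_def)
  have int: "chambers (zero_flat V a {i}) a I = Rp \<inter> Rm"
  proof (intro set_eqI iffI)
    fix B assume "B \<in> chambers (zero_flat V a {i}) a I"
    then show "B \<in> Rp \<inter> Rm"
      using up down by (auto simp: chambers_def zero_flat_def)
  next
    fix B assume "B \<in> Rp \<inter> Rm"
    then obtain x y where B: "B \<subseteq> I" and x: "x \<in> V" "has_signs a I B x" "0 < a i \<bullet> x"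
      and y: "y \<in> V" "has_signs a I B y" "a i \<bullet> y < 0"
      by (auto simp: Rp_def Rm_def)
    \<comment> \<open>Up to positive scaling, the point where the segment from \<open>x\<close> to
      \<open>y\<close> crosses hyperplane \<open>i\<close>; both weights are positive.\<close>
    define z where "z = (- (a i \<bullet> y)) *\<^sub>R x + (a i \<bullet> x) *\<^sub>R y"
    have "has_signs a I B z"
      unfolding z_def by (rule has_signs_convex) (use x y in auto)
    moreover have "z \<in> zero_flat V a {i}"
      unfolding zero_flat_def
    proof (intro CollectI conjI ballI)
      show "z \<in> V"
        unfolding z_def using V x(1) y(1) by (intro subspace_add subspace_scale)
      show "a j \<bullet> z = 0" if "j \<in> {i}" for j
        using that by (simp add: z_def inner_diff_right)
    qed
    ultimately show "B \<in> chambers (zero_flat V a {i}) a I"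
      using B by (auto simp: chambers_def)
  qed
  have ins: "chambers V a (insert i I) = insert i ` Rp \<union> Rm"
  proof (intro set_eqI iffI)
    fix B assume "B \<in> chambers V a (insert i I)"
    then obtain x where x: "B \<subseteq> insert i I" "x \<in> V" "has_signs a (insert i I) B x"
      by (auto simp: chambers_def)
    then have sg: "has_signs a I (B - {i}) x"
      using I(2) by (auto simp: has_signs_def)
    show "B \<in> insert i ` Rp \<union> Rm"
    proof (cases "i \<in> B")
      case True
      then have "0 < a i \<bullet> x"
        using x(3) by (simp add: has_signs_def)
      then have "B - {i} \<in> Rp"
        using x(1,2) sg by (auto simp: Rp_def)
      then show ?thesis
        using True by (auto intro!: image_eqI[of _ _ "B - {i}"])
    next
      case False
      then have "a i \<bullet> x < 0"
        using x(3) by (simp add: has_signs_def)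
      then show ?thesis
        using False x(1,2) sg by (auto simp: Rm_def)
    qed
  next
    fix B assume "B \<in> insert i ` Rp \<union> Rm"
    then show "B \<in> chambers V a (insert i I)"
    proof
      assume "B \<in> insert i ` Rp"
      then obtain C x where C: "B = insert i C" "C \<subseteq> I" and x: "x \<in> V" "has_signs a I C x" "0 < a i \<bullet> x"
        by (auto simp: Rp_def)
      then have "has_signs a (insert i I) B x"
        using I(2) by (auto simp: has_signs_def)
      then show ?thesis
        using C x(1) by (auto simp: chambers_def)
    next
      assume "B \<in> Rm"
      then obtain x where B: "B \<subseteq> I" and x: "x \<in> V" "has_signs a I B x" "a i \<bullet> x < 0"
        by (auto simp: Rm_def)
      then have "has_signs a (insert i I) B x"
        using I(2) by (auto simp: has_signs_def)
      then show ?thesis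
        using B x(1) by (auto simp: chambers_def)
    qed
  qed
  have "inj_on (insert i) Rp"
    using I(2) by (intro inj_onI) (metis (mono_tags, lifting) Rp_def insert_ident mem_Collect_eq subsetD)
  moreover have "insert i ` Rp \<inter> Rm = {}"
    using I(2) by (auto simp: Rm_def)
  ultimately have "card (chambers V a (insert i I)) = card Rp + card Rm"
    using fin by (simp add: ins card_Un_disjoint card_image)
  also have "\<dots> = card (Rp \<union> Rm) + card (Rp \<inter> Rm)"
    using fin by (rule card_Un_Int)
  finally show ?thesis
    by (simp add: un int)
qed

text \<open>Zaslavsky's theorem. A zero normal vector gives no chambers, and it pairs off the terms of
  the sum.\<close>

theorem card_chambers:
  fixes V :: "'v::euclidean_space set"
  assumes "finite I" "subspace V"
  shows "int (card (chambers V a I)) =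
           (\<Sum>S\<in>Pow I. (-1) ^ card S * (-1) ^ (dim V + dim (zero_flat V a S)))"
  using assms
proof (induction I arbitrary: V rule: finite_induct)
  case empty
  have "chambers V a {} = {{}}"
    using subspace_0[OF empty] by (auto simp: chambers_def has_signs_def)
  then show ?case
    by simp
next
  case (insert i I)
  let ?W = "zero_flat V a {i}"
  have card_ins: "card (insert i S) = Suc (card S)" if "S \<in> Pow I" for S
    using that insert.hyps by (auto intro!: card_insert_disjoint intro: finite_subset)
  have split: "(\<Sum>S\<in>Pow (insert i I). (-1) ^ card S * (-1) ^ (dim V + dim (zero_flat V a S))) =
      (\<Sum>S\<in>Pow I. (-1) ^ card S * (-1) ^ (dim V + dim (zero_flat V a S))) +
      (\<Sum>S\<in>Pow I. - ((-1) ^ card S * (-1) ^ (dim V + dim (zero_flat ?W a S)) :: int))"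
    unfolding sum_Pow_insert[OF insert.hyps]
    by (intro arg_cong2[of _ _ _ _ "(+)"] sum.cong refl)
      (simp add: card_ins flip: zero_flat_insert)
  show ?case
  proof (cases "\<exists>v\<in>V. a i \<bullet> v \<noteq> 0")
    case True
    then obtain v where v: "v \<in> V" "a i \<bullet> v \<noteq> 0"
      by blast
    \<comment> \<open>The lost dimension turns the minus of the second sum into a plus, so that this
      sum is the chamber count of the restriction.\<close>
    have "dim V = Suc (dim ?W)"
      using v insert.prems by (intro dim_zero_flat_singleton)
    then have "(\<Sum>S\<in>Pow I. - ((-1) ^ card S * (-1) ^ (dim V + dim (zero_flat ?W a S)) :: int)) =
        int (card (chambers ?W a I))"
      using insert.IH[of ?W] insert.prems by (simp add: subspace_zero_flat)
    moreover have "card (chambers V a (insert i I)) = card (chambers V a I) + card (chambers ?W a I)"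
      using insert.hyps insert.prems v by (rule card_chambers_insert)
    ultimately show ?thesis
      using insert.IH[of V] insert.prems by (simp add: split)
  next
    case False
    then have "?W = V"
      by (auto simp: zero_flat_def)
    moreover have "chambers V a (insert i I) = {}"
      using False by (force simp: chambers_def has_signs_def split: if_splits)
    ultimately show ?thesis
      unfolding split by (simp add: sum_negf)
  qed
qed

section \<open>Sums over the flats\<close>

text \<open>Groups index sets by the flat they cut out. The condition on \<open>Q\<close> ensures
  that the subsets of \<open>J\<close> comprise the whole fibre over every selected flat. The three
  sums below are instances, with \<open>J\<close> the normals that vanish at a point or on a given
  flat.\<close>

lemma whitney_sum_over_flats:
  fixes g :: "'v::real_inner set \<Rightarrow> int"
  assumes I: "finite I" and J: "J \<subseteq> I"
    and Q: "\<And>S. S \<subseteq> I \<Longrightarrow> Q (zero_flat V a S) \<longleftrightarrow> S \<subseteq> J"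
  shows "(\<Sum>f | f \<in> zero_flat V a ` Pow I \<and> Q f. g f * whitney_sum V a I f) =
           (\<Sum>S\<in>Pow J. (-1) ^ card S * g (zero_flat V a S))"
proof -
  let ?F = "{f. f \<in> zero_flat V a ` Pow I \<and> Q f}"
  have J': "{S \<in> Pow J. zero_flat V a S = f} = {S. S \<subseteq> I \<and> zero_flat V a S = f}" if "f \<in> ?F" for f
  proof (intro set_eqI iffI)
    fix S assume "S \<in> {S. S \<subseteq> I \<and> zero_flat V a S = f}"
    then show "S \<in> {S \<in> Pow J. zero_flat V a S = f}"
      using that Q[of S] by auto
  qed (use J in auto)
  have "(\<Sum>S\<in>Pow J. (-1) ^ card S * g (zero_flat V a S)) =
      (\<Sum>f\<in>?F. \<Sum>S | S \<in> Pow J \<and> zero_flat V a S = f. (-1) ^ card S * g (zero_flat V a S))"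
    using I J Q by (intro sum.group[symmetric]) (auto intro: finite_subset)
  also have "\<dots> = (\<Sum>f\<in>?F. g f * whitney_sum V a I f)"
  proof (rule sum.cong[OF refl])
    fix f assume "f \<in> ?F"
    then show "(\<Sum>S | S \<in> Pow J \<and> zero_flat V a S = f. (-1) ^ card S * g (zero_flat V a S)) =
        g f * whitney_sum V a I f"
      unfolding J'[OF \<open>f \<in> ?F\<close>] by (simp add: whitney_sum_def sum_distrib_left mult.commute)
  qed
  finally show ?thesis ..
qed

lemma sum_Pow_alternating:
  assumes "finite J"
  shows "(\<Sum>S\<in>Pow J. (-1) ^ card S :: int) = of_bool (J = {})"
proof (cases "J = {}")
  case False
  then obtain i where i: "i \<in> J"
    by blast
  have fin: "finite (J - {i})" and "i \<notin> J - {i}"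
    using assms by auto
  have "(\<Sum>S\<in>Pow (J - {i}). (-1) ^ card (insert i S)) =
      (\<Sum>S\<in>Pow (J - {i}). - ((-1) ^ card S :: int))"
    using fin by (intro sum.cong refl) (subst card_insert_disjoint, auto intro: finite_subset)
  then have "(\<Sum>S\<in>Pow (insert i (J - {i})). (-1) ^ card S :: int) = 0"
    unfolding sum_Pow_insert[OF fin \<open>i \<notin> J - {i}\<close>] by (simp add: sum_negf)
  then show ?thesis
    using False i by (simp add: insert_absorb)
qed simp

text \<open>A flat contains \<open>x\<close> exactly if all normals that cut it out are orthogonal
  to \<open>x\<close>, so an alternating sum over all sets of such normals remains.\<close>

lemma sum_whitney_sum_through:
  assumes I: "finite I" and x: "x \<in> V"
  shows "(\<Sum>f | f \<in> zero_flat V a ` Pow I \<and> x \<in> f. whitney_sum V a I f) =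
           of_bool (\<forall>i\<in>I. a i \<bullet> x \<noteq> 0)"
proof -
  let ?J = "{i \<in> I. a i \<bullet> x = 0}"
  have "(\<Sum>f | f \<in> zero_flat V a ` Pow I \<and> x \<in> f. 1 * whitney_sum V a I f) =
      (\<Sum>S\<in>Pow ?J. (-1) ^ card S * 1)"
    using I x by (intro whitney_sum_over_flats) (auto simp: zero_flat_def)
  moreover have "?J = {} \<longleftrightarrow> (\<forall>i\<in>I. a i \<bullet> x \<noteq> 0)"
    by blast
  ultimately show ?thesis
    using I by (simp add: sum_Pow_alternating)
qed

text \<open>The sign rule replaces the absolute value by a weight depending only on the dimension of
  the flat; the regrouped sum is then Zaslavsky's formula for the hyperplanes through
  \<open>x\<close>.\<close>

lemma sum_abs_whitney_sum_through:
  fixes V :: "'v::euclidean_space set"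
  assumes I: "finite I" and V: "subspace V" and x: "x \<in> V"
  shows "(\<Sum>f | f \<in> zero_flat V a ` Pow I \<and> x \<in> f. \<bar>whitney_sum V a I f\<bar>) =
           int (card (chambers V a {i \<in> I. a i \<bullet> x = 0}))"
proof -
  let ?J = "{i \<in> I. a i \<bullet> x = 0}"
  have "(\<Sum>f | f \<in> zero_flat V a ` Pow I \<and> x \<in> f. (-1) ^ (dim V + dim f) * whitney_sum V a I f) =
      (\<Sum>S\<in>Pow ?J. (-1) ^ card S * (-1) ^ (dim V + dim (zero_flat V a S)))"
    using I x by (intro whitney_sum_over_flats) (auto simp: zero_flat_def)
  then show ?thesis
    using I V by (simp add: abs_whitney_sum card_chambers)
qed

text \<open>The summation identity that characterizes the Moebius function of the flats. Here
  \<open>nz\<close> matters: a normal vanishing on all of \<open>V\<close> would make the sum over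
  all flats containing \<open>V\<close> zero instead of one.\<close>

lemma sum_whitney_sum_below:
  assumes I: "finite I" and T: "T \<subseteq> I" and nz: "\<And>i. i \<in> I \<Longrightarrow> \<exists>v\<in>V. a i \<bullet> v \<noteq> 0"
  shows "(\<Sum>f | f \<in> zero_flat V a ` Pow I \<and> zero_flat V a T \<subseteq> f. whitney_sum V a I f) =
           of_bool (zero_flat V a T = V)"
proof -
  let ?J = "{i \<in> I. \<forall>x\<in>zero_flat V a T. a i \<bullet> x = 0}"
  have "(\<Sum>f | f \<in> zero_flat V a ` Pow I \<and> zero_flat V a T \<subseteq> f. 1 * whitney_sum V a I f) =
      (\<Sum>S\<in>Pow ?J. (-1) ^ card S * 1)"
    using I by (intro whitney_sum_over_flats) (auto simp: zero_flat_def)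
  moreover have "?J = {} \<longleftrightarrow> zero_flat V a T = V"
  proof
    assume "?J = {}"
    moreover have "T \<subseteq> ?J"
      using T by (auto simp: zero_flat_def)
    ultimately have "T = {}"
      by blast
    then show "zero_flat V a T = V"
      by simp
  next
    assume "zero_flat V a T = V"
    then show "?J = {}"
      using nz by auto
  qed
  ultimately show ?thesis
    using I by (simp add: sum_Pow_alternating)
qed

text \<open>Solving the summation identity for its term at \<open>u\<close> gives the defining
  recursion, so induction on the number of strictly larger sets applies.\<close>

lemma poset_moebius_unique:
  assumes A: "finite A" "r \<in> A" "\<And>u. u \<in> A \<Longrightarrow> u \<subseteq> r"
    and g: "\<And>u. u \<in> A \<Longrightarrow> (\<Sum>w | w \<in> A \<and> u \<subseteq> w. g w) = of_bool (u = r)"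
    and u: "u \<in> A"
  shows "poset_moebius A r u = g u"
  using u
proof (induction "card {w \<in> A. u \<subset> w}" arbitrary: u rule: less_induct)
  case less
  have IH: "poset_moebius A r w = g w" if "w \<in> A" "u \<subset> w" for w
  proof -
    have "{v \<in> A. w \<subset> v} \<subset> {v \<in> A. u \<subset> v}"
      using that by auto
    then show ?thesis
      using less.hyps that A(1) by (simp add: psubset_card_mono)
  qed
  have eq: "{w. w \<in> A \<and> u \<subseteq> w} = insert u {w \<in> A. u \<subset> w \<and> w \<subseteq> r}"
    using less.prems A(3) by auto
  have sum: "g u + (\<Sum>w\<in>{w \<in> A. u \<subset> w \<and> w \<subseteq> r}. g w) = of_bool (u = r)"
    using g[OF less.prems] A(1) by (simp add: eq)
  have "(\<Sum>w\<in>{w \<in> A. u \<subset> w \<and> w \<subseteq> r}. poset_moebius A r w) =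
      (\<Sum>w\<in>{w \<in> A. u \<subset> w \<and> w \<subseteq> r}. g w)"
    by (intro sum.cong refl) (simp add: IH)
  moreover have "(\<Sum>w\<in>{w \<in> A. u \<subset> w \<and> w \<subseteq> r}. g w) = 0" if "u = r"
    using that by (intro sum.neutral) auto
  ultimately show ?case
    using less.prems A(1,2) A(3)[OF less.prems] sum by (subst poset_moebius.simps) (cases "u = r"; simp)
qed

section \<open>Orientations as chambers\<close>

text \<open>The maps \<open>p\<close> and \<open>q\<close> fix a reference direction for each edge.
  Edges without a tie at \<open>x\<close> are directed by \<open>x\<close> itself; on the tied edges
  a realizing point selects a chamber, and a point of a chamber conversely breaks the ties.\<close>

lemma card_compatible_orientations:
  fixes s :: "(real ^ 'n::finite) set" and p q :: "'n set \<Rightarrow> 'n"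
  defines "a \<equiv> \<lambda>e. axis (q e) 1 - axis (p e) (1::real)"
  assumes s: "subspace s" and x: "x \<in> s"
    and E: "\<And>e. e \<in> E \<Longrightarrow> p e \<noteq> q e \<and> {p e, q e} = e"
  shows "card {A. orientation E A \<and> acyclic A \<and> compatible A x \<and> realizable_in A s} =
           card (chambers s a {e \<in> E. a e \<bullet> x = 0})"
proof -
  let ?O = "{A. orientation E A \<and> acyclic A \<and> compatible A x \<and> realizable_in A s}"
  let ?J = "{e \<in> E. a e \<bullet> x = 0}"
  define \<phi> where "\<phi> A = {e \<in> ?J. (p e, q e) \<in> A}" for A
  have a: "a e \<bullet> y = y $ q e - y $ p e" for e and y :: "real ^ 'n"
    by (simp add: a_def inner_diff_left inner_axis')
  have edge: "(i = p {i, j} \<and> j = q {i, j}) \<or> (i = q {i, j} \<and> j = p {i, j})" if "{i, j} \<in> E" for i j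
    using E[OF that] by (metis doubleton_eq_iff)
  have mem: "(p e, q e) \<in> A \<longleftrightarrow> (q e, p e) \<notin> A" if "orientation E A" "e \<in> E" for A e
    using that E[OF that(2)] unfolding orientation_def by metis
  have "inj_on \<phi> ?O"
  proof (rule inj_onI)
    fix A B assume A: "A \<in> ?O" and B: "B \<in> ?O" and eq: "\<phi> A = \<phi> B"
    have pq: "(p e, q e) \<in> A \<longleftrightarrow> (p e, q e) \<in> B" if e: "e \<in> E" for e
    proof (cases "a e \<bullet> x = 0")
      case True
      then show ?thesis
        using eq e by (auto simp: \<phi>_def)
    next
      case False
      \<comment> \<open>Compatibility leaves no choice on an edge where \<open>x\<close> has no tie,
        so the tied edges recorded by \<open>\<phi>\<close> determine the orientation.\<close>
      have "(p e, q e) \<in> C \<longleftrightarrow> x $ p e < x $ q e" if "C \<in> ?O" for C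
        using that mem[of C e] e False unfolding compatible_def a by force
      then show ?thesis
        using A B by blast
    qed
    show "A = B"
    proof (intro set_eqI)
      fix ij :: "'n \<times> 'n"
      obtain i j where ij: "ij = (i, j)"
        by (cases ij)
      show "ij \<in> A \<longleftrightarrow> ij \<in> B"
      proof (cases "{i, j} \<in> E")
        case True
        then show ?thesis
          using edge[OF True] pq[OF True] mem[of A, OF _ True] mem[of B, OF _ True] A B ij by auto
      next
        case False
        then show ?thesis
          using A B ij by (auto simp: orientation_def)
      qed
    qed
  qed
  moreover have "\<phi> ` ?O = chambers s a ?J"
  proof (intro set_eqI iffI)
    fix B assume "B \<in> \<phi> ` ?O"
    then obtain A where A: "A \<in> ?O" and B: "B = \<phi> A"
      by blast
    then obtain y where y: "y \<in> s" "\<And>i j. (i, j) \<in> A \<Longrightarrow> y $ i < y $ j"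
      by (auto simp: realizable_in_def)
    have "has_signs a ?J B y"
      using A mem[of A] y(2) by (auto simp: has_signs_def B \<phi>_def a)
    then show "B \<in> chambers s a ?J"
      using y(1) by (auto simp: chambers_def B \<phi>_def)
  next
    fix B assume "B \<in> chambers s a ?J"
    then obtain y where B: "B \<subseteq> ?J" and y: "y \<in> s" "has_signs a ?J B y"
      by (auto simp: chambers_def)
    \<comment> \<open>For this \<open>c\<close>, moving from \<open>x\<close> in the direction
      \<open>y\<close> keeps every strict comparison of \<open>x\<close> along an edge, while the
      ties are broken according to \<open>y\<close>. The orientation \<open>A\<close> then points
      upward in \<open>z\<close>.\<close>
    obtain c where c: "0 < c" "\<And>e. e \<in> E \<Longrightarrow> 0 < a e \<bullet> x \<Longrightarrow> 0 < a e \<bullet> (x + c *\<^sub>R y)"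
      "\<And>e. e \<in> E \<Longrightarrow> a e \<bullet> x < 0 \<Longrightarrow> a e \<bullet> (x + c *\<^sub>R y) < 0"
      using perturb_keeps_signs[of E a x y] by auto
    define z where "z = x + c *\<^sub>R y"
    define A where "A = {(i, j). {i, j} \<in> E \<and> z $ i < z $ j}"
    have zs: "z \<in> s"
      using s x y(1) by (simp add: z_def subspace_add subspace_scale)
    have tie: "a e \<bullet> z = c * (a e \<bullet> y)" if "e \<in> ?J" for e
      using that by (simp add: z_def inner_right_distrib)
    have nz: "z $ p e \<noteq> z $ q e" if e: "e \<in> E" for e
    proof (cases "a e \<bullet> x = 0")
      case True
      then have "a e \<bullet> z \<noteq> 0"
        using tie[of e] e c(1) y(2) by (auto simp: has_signs_def split: if_splits)
      then show ?thesis
        by (simp add: a)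
    next
      case False
      then have "a e \<bullet> z \<noteq> 0"
        using c(2,3)[OF e] unfolding z_def by fastforce
      then show ?thesis
        by (simp add: a)
    qed
    have nz': "z $ i \<noteq> z $ j" if "{i, j} \<in> E" for i j
      using nz[OF that] edge[OF that] by metis
    have "orientation E A"
      unfolding orientation_def
    proof (intro conjI allI impI)
      show "\<forall>(i, j)\<in>A. {i, j} \<in> E"
        by (auto simp: A_def)
      fix i j assume ij: "{i, j} \<in> E"
      then have "{j, i} \<in> E"
        by (simp add: insert_commute)
      then show "(i, j) \<in> A \<longleftrightarrow> (j, i) \<notin> A"
        using ij nz'[OF ij] by (auto simp: A_def)
    qed
    moreover have "acyclic A"
    proof -
      have "z $ i < z $ j" if "(i, j) \<in> A\<^sup>+" for i j
        using that by (induction rule: trancl_induct) (auto simp: A_def)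
      then show ?thesis
        unfolding acyclic_def by blast
    qed
    moreover have "compatible A x"
      unfolding compatible_def
    proof (intro ballI, clarify)
      fix i j assume "(i, j) \<in> A"
      then have ij: "{i, j} \<in> E" "z $ i < z $ j"
        by (auto simp: A_def)
      show "x $ i \<le> x $ j"
        using edge[OF ij(1)] ij(2) c(2,3)[OF ij(1)] unfolding a z_def[symmetric]
        by (smt (verit))
    qed
    moreover have "realizable_in A s"
      unfolding realizable_in_def using zs by (auto simp: A_def)
    moreover have "\<phi> A = B"
    proof -
      have "(p e, q e) \<in> A \<longleftrightarrow> e \<in> B" if e: "e \<in> ?J" for e
      proof -
        have "(p e, q e) \<in> A \<longleftrightarrow> 0 < a e \<bullet> z"
          using e E[of e] by (auto simp: A_def a)
        also have "\<dots> \<longleftrightarrow> 0 < a e \<bullet> y"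
          using tie[OF e] c(1) by (simp add: zero_less_mult_iff)
        also have "\<dots> \<longleftrightarrow> e \<in> B"
          using bspec[OF y(2)[unfolded has_signs_def] e] by (simp split: if_splits)
        finally show ?thesis .
      qed
      then show ?thesis
        using B by (auto simp: \<phi>_def)
    qed
    ultimately show "B \<in> \<phi> ` ?O"
      by blast
  qed
  ultimately show ?thesis
    using card_image[of \<phi> ?O] by simp
qed

section \<open>The clutter polytope\<close>

lemma subspace_line_sum_space: "subspace (line_sum_space Ls :: (real ^ 'n::finite) set)"
  unfolding line_sum_space_def subspace_def
proof (intro conjI ballI allI CollectI)
  fix x y :: "real ^ 'n" and c :: real and L l m
  assume x: "x \<in> {x. \<forall>L\<in>set Ls. \<forall>l\<in>L. \<forall>m\<in>L. (\<Sum>i\<in>l. x $ i) = (\<Sum>i\<in>m. x $ i)}"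
    and L: "L \<in> set Ls" "l \<in> L" "m \<in> L"
  then have eq: "(\<Sum>i\<in>l. x $ i) = (\<Sum>i\<in>m. x $ i)"
    by blast
  then show "(\<Sum>i\<in>l. (c *\<^sub>R x) $ i) = (\<Sum>i\<in>m. (c *\<^sub>R x) $ i)"
    by (simp flip: sum_distrib_left)
  assume "y \<in> {x. \<forall>L\<in>set Ls. \<forall>l\<in>L. \<forall>m\<in>L. (\<Sum>i\<in>l. x $ i) = (\<Sum>i\<in>m. x $ i)}"
  then have "(\<Sum>i\<in>l. y $ i) = (\<Sum>i\<in>m. y $ i)"
    using L by blast
  with eq show "(\<Sum>i\<in>l. (x + y) $ i) = (\<Sum>i\<in>m. (x + y) $ i)"
    by (simp add: sum.distrib)
qed simp

text \<open>Equal line sizes enter here: they put the centre of the cube into the space, and hence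
  into every flat.\<close>

lemma const_in_line_sum_space:
  assumes "same_line_size Ls"
  shows "(\<chi> i. c) \<in> line_sum_space Ls"
proof -
  have "real (card l) * c = real (card m) * c" if L: "L \<in> set Ls" "l \<in> L" "m \<in> L" for L l m
  proof -
    have "card l = card m"
      using assms L unfolding same_line_size_def by blast
    then show ?thesis
      by simp
  qed
  then show ?thesis
    unfolding line_sum_space_def by simp
qed

lemma centre_in_unit_box: "(\<chi> i. 1/2) \<in> box 0 (1 :: real ^ 'n::finite)"
  by (simp add: mem_box_cart)

text \<open>The space meets the open cube at the centre, so taking the relative interior commutes
  with the intersection.\<close>

lemma rel_interior_clutter_polytope:
  fixes Ls :: "'n::finite set set list"
  assumes "same_line_size Ls"
  shows "rel_interior (clutter_polytope Ls) = box 0 1 \<inter> line_sum_space Ls"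
proof -
  have ne: "box 0 (1 :: real ^ 'n) \<noteq> {}"
    using centre_in_unit_box by blast
  have "rel_interior (cbox 0 (1 :: real ^ 'n)) = box 0 1"
    using ne interior_cbox[of 0 "1 :: real ^ 'n"]
      rel_interior_nonempty_interior[of "cbox 0 (1 :: real ^ 'n)"] by simp
  then show ?thesis
    using const_in_line_sum_space[OF assms, of "1/2"] centre_in_unit_box
    unfolding clutter_polytope_def
    by (subst convex_affine_rel_interior_Int)
      (auto simp: subspace_line_sum_space subspace_imp_affine)
qed

text \<open>A small multiple of any \<open>x\<close> in \<open>f\<close>, added to \<open>c\<close>,
  stays in \<open>U\<close> and hence in \<open>g\<close>; subtracting \<open>c\<close> and
  rescaling gives \<open>x\<close>. With \<open>U\<close> the open cube, flats can be compared by
  their traces.\<close>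

lemma subspace_subset_if_locally_subset:
  fixes f g :: "'v::real_normed_vector set"
  assumes f: "subspace f" and g: "subspace g" and U: "open U" and c: "c \<in> U" "c \<in> f" "c \<in> g"
    and sub: "U \<inter> f \<subseteq> g"
  shows "f \<subseteq> g"
proof
  fix x assume x: "x \<in> f"
  have lim: "((\<lambda>e. c + e *\<^sub>R x) \<longlongrightarrow> c + 0 *\<^sub>R x) (at_right 0)"
    by (intro tendsto_intros)
  have "\<forall>\<^sub>F e in at_right 0. c + e *\<^sub>R x \<in> U"
    using topological_tendstoD[OF lim U] c(1) by simp
  then have "\<forall>\<^sub>F e in at_right 0. 0 < e \<and> c + e *\<^sub>R x \<in> U"
    using eventually_at_right_less[of 0] by eventually_elim simp
  then obtain e where e: "0 < e" "c + e *\<^sub>R x \<in> U"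
    using eventually_happens' trivial_limit_at_right_real by blast
  have "c + e *\<^sub>R x \<in> g"
    using sub e f c(2) x by (auto simp: subspace_add subspace_scale)
  then have "(c + e *\<^sub>R x) - c \<in> g"
    using g c(3) by (intro subspace_diff)
  then have "e *\<^sub>R x \<in> g"
    by simp
  then have "(1 / e) *\<^sub>R (e *\<^sub>R x) \<in> g"
    by (rule subspace_scale[OF g])
  then show "x \<in> g"
    using e(1) by simp
qed

section \<open>Lattice points in dilates, and interchange of sums\<close>

lemma dilate_count_subspace:
  fixes f :: "(real ^ 'n::finite) set"
  assumes f: "subspace f" and t: "0 < t"
  shows "dilate_count (Q \<inter> f) t = card {x \<in> integer_points. x \<in> f \<and> (1 / real t) *\<^sub>R x \<in> Q}"
proof -
  have "integer_points \<inter> (\<lambda>x. real t *\<^sub>R x) ` (Q \<inter> f) =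
      {x \<in> integer_points. x \<in> f \<and> (1 / real t) *\<^sub>R x \<in> Q}"
  proof (intro set_eqI iffI)
    fix x assume "x \<in> {x \<in> integer_points. x \<in> f \<and> (1 / real t) *\<^sub>R x \<in> Q}"
    moreover have "x = real t *\<^sub>R ((1 / real t) *\<^sub>R x)"
      using t by simp
    ultimately show "x \<in> integer_points \<inter> (\<lambda>x. real t *\<^sub>R x) ` (Q \<inter> f)"
      using f subspace_scale by blast
  qed (use t f in \<open>auto simp: subspace_scale\<close>)
  then show ?thesis
    by (simp add: dilate_count_def)
qed

lemma finite_integer_points_cube:
  "finite {x :: real ^ 'n::finite. x \<in> integer_points \<and> (\<forall>i. 0 \<le> x $ i \<and> x $ i \<le> real t)}"
proof (rule finite_subset)
  show "{x :: real ^ 'n. x \<in> integer_points \<and> (\<forall>i. 0 \<le> x $ i \<and> x $ i \<le> real t)} \<subseteq>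
      vec_lambda ` (UNIV \<rightarrow>\<^sub>E {z \<in> \<int>. \<bar>z\<bar> \<le> real t})"
  proof
    fix x :: "real ^ 'n"
    assume "x \<in> {x. x \<in> integer_points \<and> (\<forall>i. 0 \<le> x $ i \<and> x $ i \<le> real t)}"
    then have "vec_nth x \<in> UNIV \<rightarrow>\<^sub>E {z \<in> \<int>. \<bar>z\<bar> \<le> real t}"
      by (auto simp: integer_points_def)
    then show "x \<in> vec_lambda ` (UNIV \<rightarrow>\<^sub>E {z \<in> \<int>. \<bar>z\<bar> \<le> real t})"
      by (intro image_eqI[of _ _ "vec_nth x"]) (simp_all only: vec_nth_inverse)
  qed
  show "finite (vec_lambda ` (UNIV \<rightarrow>\<^sub>E {z \<in> \<int>. \<bar>z\<bar> \<le> real t}) :: (real ^ 'n) set)"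
    by (intro finite_imageI finite_PiE finite finite_abs_int_segment)
qed

lemma sum_card_interchange:
  fixes g :: "'b \<Rightarrow> int"
  assumes "finite F" "finite Z"
  shows "(\<Sum>f\<in>F. g f * int (card {x \<in> Z. R x f})) = (\<Sum>x\<in>Z. \<Sum>f | f \<in> F \<and> R x f. g f)"
proof -
  have "(\<Sum>f\<in>F. g f * int (card {x \<in> Z. R x f})) = (\<Sum>f\<in>F. \<Sum>x | x \<in> Z \<and> R x f. g f)"
    by (simp add: mult.commute)
  also have "\<dots> = (\<Sum>x\<in>Z. \<Sum>f | f \<in> F \<and> R x f. g f)"
    using assms by (rule sum.swap_restrict)
  finally show ?thesis .
qed

section \<open>The arrangement of a clutter and the two counts of labellings\<close>

theorem theorem4p2:
  fixes Ls :: "'n::finite set set list"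
    and s P P0 :: "(real ^ 'n) set"
    and H \<L> :: "(real ^ 'n) set set"
    and t :: nat
  assumes clutter: "multiple_covering_clutter UNIV Ls"
    and same_size: "same_line_size Ls"
    and s: "s = line_sum_space Ls"
    and P: "P = clutter_polytope Ls"
    and P0: "P0 = rel_interior P"
    and H: "H = clutter_arrangement Ls"
    and L: "\<L> = intersection_poset P0 H"
    and latin_exists: "\<exists>x :: real ^ 'n. latin_labelling Ls x"
    and t: "t > 0"
  shows "int (latin_count_open Ls t) =
           (\<Sum>u\<in>\<L>. poset_moebius \<L> P0 u * int (dilate_count (box 0 1 \<inter> flat_of s P0 H u) t)) \<and>
         int (latin_count_closed Ls t) =
           (\<Sum>u\<in>\<L>. \<bar>poset_moebius \<L> P0 u\<bar> * int (dilate_count (cbox 0 1 \<inter> flat_of s P0 H u) t))"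
proof -
  define E where "E = clutter_graph Ls"
  have "\<forall>e\<in>E. \<exists>i j. i \<noteq> j \<and> e = {i, j}"
    by (auto simp: E_def clutter_graph_def)
  \<comment> \<open>The order of the endpoints is an arbitrary choice; it fixes the sign of the
    normal, not the hyperplane.\<close>
  then obtain p q where pq: "\<And>e. e \<in> E \<Longrightarrow> p e \<noteq> q e \<and> {p e, q e} = e"
    by metis
  define a where "a = (\<lambda>e. axis (q e) 1 - axis (p e) (1::real))"
  have a: "a e \<bullet> y = y $ q e - y $ p e" for e and y :: "real ^ 'n"
    by (simp add: a_def inner_diff_left inner_axis')
  have E_iff: "{i, j} \<in> E \<longleftrightarrow> i \<noteq> j \<and> collinear_points Ls i j" for i j
    unfolding E_def clutter_graph_def collinear_points_def
    by (auto simp: doubleton_eq_iff)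
  have edge: "a {i, j} \<bullet> y = 0 \<longleftrightarrow> y $ i = y $ j" if "{i, j} \<in> E" for i j and y :: "real ^ 'n"
  proof -
    have "(i = p {i, j} \<and> j = q {i, j}) \<or> (i = q {i, j} \<and> j = p {i, j})"
      using pq[OF that] by (metis doubleton_eq_iff)
    then show ?thesis
      unfolding a by auto
  qed
  have sub: "subspace s"
    by (simp add: s subspace_line_sum_space)
  have latin_iff: "latin_labelling Ls x \<longleftrightarrow> x \<in> integer_points \<and> x \<in> s \<and> (\<forall>e\<in>E. a e \<bullet> x \<noteq> 0)" for x
  proof -
    have "(\<forall>i j. i \<noteq> j \<and> collinear_points Ls i j \<longrightarrow> x $ i \<noteq> x $ j) \<longleftrightarrow> (\<forall>e\<in>E. a e \<bullet> x \<noteq> 0)"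
    proof (intro iffI ballI allI impI)
      fix e assume "\<forall>i j. i \<noteq> j \<and> collinear_points Ls i j \<longrightarrow> x $ i \<noteq> x $ j" "e \<in> E"
      then show "a e \<bullet> x \<noteq> 0"
        using pq[of e] E_iff[of "p e" "q e"] unfolding a by force
    qed (use E_iff edge in blast)
    then show ?thesis
      by (auto simp: latin_labelling_def s)
  qed
  \<comment> \<open>The latin labelling shows that no edge hyperplane contains \<open>s\<close>.
    Hence the proviso in the arrangement discards no edge, and no normal vanishes on
    \<open>s\<close>.\<close>
  obtain x0 where x0: "x0 \<in> s" "\<And>e. e \<in> E \<Longrightarrow> a e \<bullet> x0 \<noteq> 0"
    using latin_exists latin_iff by blast
  \<comment> \<open>Distinct edges may give the same trace on \<open>s\<close>; indexing by edges
    allows such repetitions.\<close>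
  define h where "h e = zero_flat s a {e}" for e
  have H_eq: "H = h ` E"
  proof (intro set_eqI iffI)
    fix X assume "X \<in> H"
    then obtain j k where jk: "{j, k} \<in> E" "X = coord_hyperplane j k \<inter> s"
      by (auto simp: H clutter_arrangement_def E_def s)
    then have "X = h {j, k}"
      using edge[OF jk(1)] by (auto simp: h_def zero_flat_def coord_hyperplane_def)
    then show "X \<in> h ` E"
      using jk by blast
  next
    fix X assume "X \<in> h ` E"
    then obtain e where e: "e \<in> E" "X = h e"
      by blast
    then have "X = coord_hyperplane (p e) (q e) \<inter> s"
      by (auto simp: h_def zero_flat_def coord_hyperplane_def a)
    moreover have "{p e, q e} \<in> E" "\<not> s \<subseteq> coord_hyperplane (p e) (q e)"
      using pq[OF e(1)] e(1) x0(1) x0(2)[OF e(1)] by (auto simp: coord_hyperplane_def a)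
    ultimately show "X \<in> H"
      unfolding H clutter_arrangement_def E_def s by blast
  qed
  have flat: "s \<inter> \<Inter>(h ` T) = zero_flat s a T" for T
    by (auto simp: h_def zero_flat_def)
  define F where "F = zero_flat s a ` Pow E"
  define w where "w = whitney_sum s a E"
  have F_eq: "F = {s \<inter> \<Inter>S | S. S \<subseteq> H}"
  proof (intro set_eqI iffI)
    fix f assume "f \<in> {s \<inter> \<Inter>S | S. S \<subseteq> H}"
    then obtain S where "S \<subseteq> h ` E" "f = s \<inter> \<Inter>S"
      by (auto simp: H_eq)
    then show "f \<in> F"
      by (auto simp: subset_image_iff F_def flat)
  next
    fix f assume "f \<in> F"
    then obtain T where "T \<subseteq> E" "f = zero_flat s a T"
      by (auto simp: F_def)
    then show "f \<in> {s \<inter> \<Inter>S | S. S \<subseteq> H}"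
      by (auto simp: H_eq simp flip: flat intro!: exI[of _ "h ` T"])
  qed
  have finF: "finite F"
    by (simp add: F_def)
  define c :: "real ^ 'n" where "c = (\<chi> i. 1/2)"
  have P0_eq: "P0 = box 0 1 \<inter> s"
    by (simp add: P0 P s rel_interior_clutter_polytope same_size)
  have cF: "c \<in> f" and F_s: "f \<subseteq> s" if "f \<in> F" for f
    using that const_in_line_sum_space[OF same_size, of "1/2"]
    by (auto simp: F_def zero_flat_def a c_def s)
  have subF: "subspace f" if "f \<in> F" for f
    using that sub by (auto simp: F_def subspace_zero_flat)
  have c_box: "c \<in> box 0 1"
    unfolding c_def by (rule centre_in_unit_box)
  have sF: "s \<in> F"
    unfolding F_def by (rule image_eqI[of _ _ "{}"]) auto
  \<comment> \<open>Near the centre a flat agrees with its trace on \<open>P0\<close>, so taking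
    traces is an order embedding of the flats.\<close>
  have P0_mono: "P0 \<inter> f \<subseteq> P0 \<inter> g \<longleftrightarrow> f \<subseteq> g" if "f \<in> F" "g \<in> F" for f g
  proof
    assume "P0 \<inter> f \<subseteq> P0 \<inter> g"
    then have "box 0 1 \<inter> f \<subseteq> g"
      using F_s[OF that(1)] by (auto simp: P0_eq)
    then show "f \<subseteq> g"
      using subspace_subset_if_locally_subset[OF subF subF open_box c_box cF cF] that by blast
  qed auto
  have inj: "inj_on (\<lambda>f. P0 \<inter> f) F"
    using P0_mono by (auto intro!: inj_onI)
  have L_eq: "\<L> = (\<lambda>f. P0 \<inter> f) ` F"
  proof -
    have "P0 \<inter> \<Inter>S = P0 \<inter> (s \<inter> \<Inter>S)" for S
      by (auto simp: P0_eq)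
    then have "{P0 \<inter> \<Inter>S | S. S \<subseteq> H} = (\<lambda>f. P0 \<inter> f) ` F"
      unfolding F_eq setcompr_eq_image image_image by presburger
    \<comment> \<open>The centre lies in every trace, so deleting the empty set from the poset
      removes nothing.\<close>
    moreover have "c \<in> P0 \<inter> f" if "f \<in> F" for f
      using cF[OF that] c_box F_s[OF that] by (auto simp: P0_eq)
    then have "{} \<notin> (\<lambda>f. P0 \<inter> f) ` F"
      by blast
    ultimately show ?thesis
      by (simp add: L intersection_poset_def)
  qed
  have P0_s: "P0 \<inter> s = P0"
    by (auto simp: P0_eq)
  have flat_of: "flat_of s P0 H (P0 \<inter> f) = f" if "f \<in> F" for f
    unfolding flat_of_def
  proof (rule the_equality)
    show "(\<exists>S\<subseteq>H. f = s \<inter> \<Inter>S) \<and> P0 \<inter> f = P0 \<inter> f"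
      using that by (auto simp: F_eq)
    fix g assume g: "(\<exists>S\<subseteq>H. g = s \<inter> \<Inter>S) \<and> P0 \<inter> g = P0 \<inter> f"
    then have "g \<in> F"
      by (auto simp: F_eq)
    then show "g = f"
      using g inj that by (auto dest: inj_onD)
  qed
  have moeb: "poset_moebius \<L> P0 (P0 \<inter> f) = w f" if f: "f \<in> F" for f
  proof -
    \<comment> \<open>The candidate function on the poset recovers the flat from its trace and
      applies \<open>w\<close>; its summation identity is transported from the flats along the order
      embedding.\<close>
    have "poset_moebius \<L> P0 (P0 \<inter> f) = w (flat_of s P0 H (P0 \<inter> f))"
    proof (rule poset_moebius_unique)
      show "finite \<L>"
        using finF by (simp add: L_eq)
      show "P0 \<in> \<L>"
        unfolding L_eq using sF P0_s by (intro image_eqI[of _ _ s]) simp_all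
      show "u \<subseteq> P0" if "u \<in> \<L>" for u
        using that by (auto simp: L_eq)
      show "P0 \<inter> f \<in> \<L>"
        using f by (simp add: L_eq)
      fix u assume "u \<in> \<L>"
      then obtain T where T: "T \<subseteq> E" "u = P0 \<inter> zero_flat s a T"
        by (auto simp: L_eq F_def)
      let ?g = "zero_flat s a T"
      have g: "?g \<in> F"
        using T by (simp add: F_def)
      have "{v. v \<in> \<L> \<and> u \<subseteq> v} = (\<lambda>f. P0 \<inter> f) ` {f. f \<in> F \<and> ?g \<subseteq> f}"
        unfolding L_eq T(2) using P0_mono[OF g] by blast
      then have "(\<Sum>v | v \<in> \<L> \<and> u \<subseteq> v. w (flat_of s P0 H v)) = (\<Sum>f | f \<in> F \<and> ?g \<subseteq> f. w f)"
        by (intro sum.reindex_cong[of "\<lambda>f. P0 \<inter> f"] inj_on_subset[OF inj]) (auto simp: flat_of)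
      also have "\<dots> = of_bool (?g = s)"
        unfolding F_def w_def using T(1) x0 by (intro sum_whitney_sum_below) auto
      also have "?g = s \<longleftrightarrow> u = P0"
        using inj_on_eq_iff[OF inj g sF] by (simp add: T(2) P0_s)
      finally show "(\<Sum>v | v \<in> \<L> \<and> u \<subseteq> v. w (flat_of s P0 H v)) = of_bool (u = P0)" .
    qed
    then show ?thesis
      by (simp add: flat_of f)
  qed
  define Zo where "Zo = {x \<in> integer_points. x \<in> s \<and> (\<forall>i. 0 < x $ i \<and> x $ i < real t)}"
  define Zc where "Zc = {x \<in> integer_points. x \<in> s \<and> (\<forall>i. 0 \<le> x $ i \<and> x $ i \<le> real t)}"
  have finZ: "finite Zo" "finite Zc"
    by (rule finite_subset[OF _ finite_integer_points_cube[of t]],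
        force simp: Zo_def Zc_def less_imp_le)+
  have dil_o: "dilate_count (box 0 1 \<inter> f) t = card {x \<in> Zo. x \<in> f}" if "f \<in> F" for f
    unfolding dilate_count_subspace[OF subF[OF that] t]
    using F_s[OF that] t
    by (intro arg_cong[of _ _ card]) (auto simp: Zo_def mem_box_cart field_simps)
  have dil_c: "dilate_count (cbox 0 1 \<inter> f) t = card {x \<in> Zc. x \<in> f}" if "f \<in> F" for f
    unfolding dilate_count_subspace[OF subF[OF that] t]
    using F_s[OF that] t
    by (intro arg_cong[of _ _ card]) (auto simp: Zc_def mem_box_cart field_simps)
  have "(\<Sum>u\<in>\<L>. poset_moebius \<L> P0 u * int (dilate_count (box 0 1 \<inter> flat_of s P0 H u) t)) =
      (\<Sum>f\<in>F. w f * int (card {x \<in> Zo. x \<in> f}))"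
    by (subst (1) L_eq) (simp add: sum.reindex[OF inj] moeb flat_of dil_o)
  also have "\<dots> = (\<Sum>x\<in>Zo. \<Sum>f | f \<in> F \<and> x \<in> f. w f)"
    using finF finZ by (intro sum_card_interchange)
  also have "\<dots> = (\<Sum>x\<in>Zo. of_bool (\<forall>e\<in>E. a e \<bullet> x \<noteq> 0))"
    unfolding F_def w_def by (intro sum.cong refl sum_whitney_sum_through) (auto simp: Zo_def)
  also have "\<dots> = int (card {x \<in> Zo. \<forall>e\<in>E. a e \<bullet> x \<noteq> 0})"
    using finZ by (simp add: Int_def)
  also have "{x \<in> Zo. \<forall>e\<in>E. a e \<bullet> x \<noteq> 0} =
      {x. latin_labelling Ls x \<and> (\<forall>i. 0 < x $ i \<and> x $ i < real t)}"
    by (auto simp: Zo_def latin_iff)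
  finally have open_count: "int (latin_count_open Ls t) =
      (\<Sum>u\<in>\<L>. poset_moebius \<L> P0 u * int (dilate_count (box 0 1 \<inter> flat_of s P0 H u) t))"
    by (simp add: latin_count_open_def)
  have "(\<Sum>u\<in>\<L>. \<bar>poset_moebius \<L> P0 u\<bar> * int (dilate_count (cbox 0 1 \<inter> flat_of s P0 H u) t)) =
      (\<Sum>f\<in>F. \<bar>w f\<bar> * int (card {x \<in> Zc. x \<in> f}))"
    by (subst (1) L_eq) (simp add: sum.reindex[OF inj] moeb flat_of dil_c)
  also have "\<dots> = (\<Sum>x\<in>Zc. \<Sum>f | f \<in> F \<and> x \<in> f. \<bar>w f\<bar>)"
    using finF finZ by (intro sum_card_interchange)
  also have "\<dots> = (\<Sum>x\<in>Zc. int (card (chambers s a {e \<in> E. a e \<bullet> x = 0})))"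
    unfolding F_def w_def using sub
    by (intro sum.cong refl sum_abs_whitney_sum_through) (auto simp: Zc_def)
  also have "\<dots> = (\<Sum>x\<in>Zc. int (card {A. orientation E A \<and> acyclic A \<and> compatible A x \<and>
      realizable_in A s}))"
    unfolding a_def
    by (intro sum.cong refl arg_cong[of _ _ int] card_compatible_orientations[symmetric] sub pq)
      (auto simp: Zc_def)
  also have "\<dots> = int (card (SIGMA x:Zc. {A. orientation E A \<and> acyclic A \<and> compatible A x \<and>
      realizable_in A s}))"
    using finZ by (simp add: card_SigmaI)
  also have "(SIGMA x:Zc. {A. orientation E A \<and> acyclic A \<and> compatible A x \<and> realizable_in A s}) =
      {(x, A). x \<in> integer_points \<inter> line_sum_space Ls \<and> (\<forall>i. 0 \<le> x $ i \<and> x $ i \<le> real t) \<and>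
       orientation (clutter_graph Ls) A \<and> acyclic A \<and>
       compatible A x \<and> realizable_in A (line_sum_space Ls)}"
    by (auto simp: Zc_def E_def s)
  finally have "int (latin_count_closed Ls t) =
      (\<Sum>u\<in>\<L>. \<bar>poset_moebius \<L> P0 u\<bar> * int (dilate_count (cbox 0 1 \<inter> flat_of s P0 H u) t))"
    by (simp add: latin_count_closed_def)
  with open_count show ?thesis
    by blast
qed

end
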